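(* Let $n,m\ge2$ be integers and let $K_n,K_m$ be the complete graphs on $n$ and $m$ vertices. Then $\mathrm{mr}_+^{\mathbb{R}}(K_n\,\Box\,K_m)$ is either $n+m-2$ or $n+m-1$.
   Context: For an $N\times N$ real symmetric matrix $A$, $\mathcal{G}(A)$ is the simple graph on $\{1,\dots,N\}$ in which distinct $i,j$ are adjacent iff $A_{ij}\ne0$ (the diagonal is unconstrained). For a simple graph $G$ on $N$ vertices, $\mathrm{mr}_+^{\mathbb{R}}(G)$ is the minimum rank of a real symmetric positive semidefinite $N\times N$ matrix $B$ with $\mathcal{G}(B)=G$. The Cartesian product $G_1\,\Box\,G_2$ of $G_1=(V_1,E_1)$ and $G_2=(V_2,E_2)$ has vertex set $V_1\times V_2$, with $(u,v)$ adjacent to $(u',v')$ iff (1) $u=u'$ and $\{v,v'\}\in E_2$, or (2) $v=v'$ and $\{u,u'\}\in E_1$. *)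

theory Defs
  imports Complex_Main "Jordan_Normal_Form.DL_Rank"
begin

text \<open>A simple graph is a pair \<open>(V, E)\<close> whose edges are two-element subsets of \<open>V\<close>.\<close>

type_synonym 'a graph = "'a set \<times> 'a set set"

abbreviation verts :: "'a graph \<Rightarrow> 'a set" where "verts G \<equiv> fst G"
abbreviation edges :: "'a graph \<Rightarrow> 'a set set" where "edges G \<equiv> snd G"

definition complete_graph :: "nat \<Rightarrow> nat graph" where
  "complete_graph n = ({1..n}, {{u, v} | u v. u \<in> {1..n} \<and> v \<in> {1..n} \<and> u \<noteq> v})"

definition cartesian_product :: "'a graph \<Rightarrow> 'b graph \<Rightarrow> ('a \<times> 'b) graph"  (infixr \<open>\<box>\<close> 70) where
  "G \<box> H =
    (verts G \<times> verts H,
     {{(u, v), (u', v')} | u v u' v'.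
        u \<in> verts G \<and> u' \<in> verts G \<and> v \<in> verts H \<and> v' \<in> verts H \<and>
        (u = u' \<and> {v, v'} \<in> edges H \<or> v = v' \<and> {u, u'} \<in> edges G)})"

definition graph_iso :: "'a graph \<Rightarrow> 'b graph \<Rightarrow> bool" where
  "graph_iso G H \<longleftrightarrow>
    (\<exists>f. bij_betw f (verts G) (verts H) \<and>
         (\<forall>u \<in> verts G. \<forall>v \<in> verts G. {u, v} \<in> edges G \<longleftrightarrow> {f u, f v} \<in> edges H))"

text \<open>Matrix indices start at 0, whereas the vertices are \<open>1, \<dots>, N\<close>.\<close>

definition graph_of_mat :: "real mat \<Rightarrow> nat graph" where
  "graph_of_mat A =
    ({1..dim_row A},
     {{i, j} | i j. i \<in> {1..dim_row A} \<and> j \<in> {1..dim_row A} \<and> i \<noteq> j \<and>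
                    A $$ (i - 1, j - 1) \<noteq> 0})"

definition psd_mat :: "nat \<Rightarrow> real mat \<Rightarrow> bool" where
  "psd_mat N A \<longleftrightarrow>
    A \<in> carrier_mat N N \<and> A\<^sup>T = A \<and> (\<forall>x \<in> carrier_vec N. x \<bullet> (A *\<^sub>v x) \<ge> 0)"

text \<open>The vertices of \<open>G\<close> need not be the numbers \<open>1, \<dots>, N\<close> (those of a Cartesian product are
  pairs), so \<open>graph_of_mat B\<close> is required to equal \<open>G\<close> up to a labelling of the vertices.  The
  choice of labelling only permutes the rows and columns of \<open>B\<close> simultaneously.  For a finite
  simple graph the set of admissible ranks is nonempty, as witnessed by the Laplacian.\<close>

definition mr_plus :: "'a graph \<Rightarrow> nat" where
  "mr_plus G =
    (LEAST r. \<exists>B. psd_mat (card (verts G)) B \<and> graph_iso (graph_of_mat B) G \<and>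
                  r = vec_space.rank (card (verts G)) B)"

end

theory Submission
  imports Defs
begin

text \<open>Lower bound: take the vertices other than \<open>(1, 1)\<close> of the first row and of the first column.
  There are no edges between these two sets, so a combination of the corresponding columns of \<open>B\<close>
  that vanishes splits, by semidefiniteness, into a vanishing combination for each of the two.  The
  vertex \<open>(2, j)\<close> has \<open>(1, j)\<close> as its only neighbour in the first row, so the first of these is
  trivial, and likewise the second.

  Upper bound: \<open>A + 2I\<close>, where \<open>A\<close> is the adjacency matrix, is the Gram matrix of the vectors
  \<open>e\<^sub>i + f\<^sub>j\<close> in \<open>\<real>\<^sup>n \<oplus> \<real>\<^sup>m\<close>, which lie in a hyperplane.\<close>

section \<open>Rank bounds\<close>

text \<open>Each index \<open>r\<close> contributes an outer product of rank at most one, and rank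
  is subadditive. The two factors may differ, so an asymmetric factorisation of a symmetric matrix
  also qualifies.\<close>

lemma rank_sum_product_entries_le:
  fixes B :: "'a :: field mat"
  assumes "finite R"
  shows "B \<in> carrier_mat N nc \<Longrightarrow>
    (\<And>i j. i < N \<Longrightarrow> j < nc \<Longrightarrow> B $$ (i, j) = (\<Sum>r\<in>R. f r i * g r j)) \<Longrightarrow>
    vec_space.rank N B \<le> card R"
  using assms
proof (induction R arbitrary: B rule: finite_induct)
  case empty
  then have "B = 0\<^sub>m N nc" by (intro eq_matI) auto
  then show ?case by (simp add: vec_space.rank_0I)
next
  case (insert r R)
  define C where "C = mat N nc (\<lambda>(i, j). f r i * g r j)"
  define D where "D = mat N nc (\<lambda>(i, j). \<Sum>r\<in>R. f r i * g r j)"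
  have CD: "C \<in> carrier_mat N nc" "D \<in> carrier_mat N nc" by (auto simp: C_def D_def)
  have "B = C + D"
    using insert by (intro eq_matI) (auto simp: C_def D_def)
  moreover have "vec_space.rank N C \<le> 1"
    by (rule vec_space.rank_le_1_product_entries[OF CD(1), of "f r" "g r"]) (auto simp: C_def)
  moreover have "vec_space.rank N D \<le> card R"
    by (rule insert.IH[OF CD(2)]) (auto simp: D_def)
  ultimately show ?case
    using vec_space.rank_subadditive[OF CD] insert.hyps by simp
qed

text \<open>The hypothesis \<open>inj\<close> says that the kernel of \<open>B\<close> meets the
  coordinate subspace of \<open>S\<close> only in zero, which makes the columns of \<open>B\<close>
  indexed by \<open>S\<close> linearly independent.\<close>

lemma card_le_rank:
  fixes B :: "'a :: field mat"
  assumes B: "B \<in> carrier_mat N N" and S: "S \<subseteq> {..<N}"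
    and inj: "\<And>v. v \<in> carrier_vec N \<Longrightarrow> (\<And>i. i < N \<Longrightarrow> i \<notin> S \<Longrightarrow> v $ i = 0) \<Longrightarrow>
      B *\<^sub>v v = 0\<^sub>v N \<Longrightarrow> v = 0\<^sub>v N"
  shows "card S \<le> vec_space.rank N B"
proof -
  interpret vec_space "TYPE('a)" N .
  have finS: "finite S" using S finite_subset by blast
  then obtain xs where xs: "set xs = S" "distinct xs" using finite_distinct_list by blast
  define d where "d = length xs"
  have xsN: "xs ! k < N" if "k < d" for k
    using S that xs(1) nth_mem[of k xs] unfolding d_def by auto
  define M where "M = mat N d (\<lambda>(i, k). B $$ (i, xs ! k))"
  have M: "M \<in> carrier_mat N d" by (simp add: M_def)
  have ker: "c = 0\<^sub>v d" if c: "c \<in> carrier_vec d" and Mc: "M *\<^sub>v c = 0\<^sub>v N" for c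
  proof -
    \<comment> \<open>The coefficient vector \<open>c\<close> is spread over the positions listed in
      \<open>xs\<close> and padded with zeros, so that a relation among the columns of
      \<open>M\<close> becomes a kernel vector of \<open>B\<close>. Writing the entries as sums
      reduces \<open>B *\<^sub>v v = M *\<^sub>v c\<close> to an exchange of summations.\<close>
    define v where "v = vec N (\<lambda>i. \<Sum>k<d. if xs ! k = i then c $ k else 0)"
    have "B *\<^sub>v v = M *\<^sub>v c"
    proof (rule eq_vecI)
      fix i assume "i < dim_vec (M *\<^sub>v c)"
      then have i: "i < N" using M by simp
      have "(B *\<^sub>v v) $ i = (\<Sum>j<N. B $$ (i, j) * (\<Sum>k<d. if xs ! k = j then c $ k else 0))"
        using B i by (simp add: v_def scalar_prod_def atLeast0LessThan)
      also have "\<dots> = (\<Sum>j<N. \<Sum>k<d. if xs ! k = j then B $$ (i, j) * c $ k else 0)"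
        by (auto simp: sum_distrib_left intro!: sum.cong)
      also have "\<dots> = (\<Sum>k<d. \<Sum>j<N. if xs ! k = j then B $$ (i, j) * c $ k else 0)"
        by (rule sum.swap)
      also have "\<dots> = (\<Sum>k<d. B $$ (i, xs ! k) * c $ k)"
        using xsN by (intro sum.cong) (auto simp: sum.delta')
      also have "\<dots> = (M *\<^sub>v c) $ i"
        using c i by (simp add: M_def scalar_prod_def atLeast0LessThan)
      finally show "(B *\<^sub>v v) $ i = (M *\<^sub>v c) $ i" .
    qed (use B M in simp)
    moreover have "v $ i = 0" if "i < N" "i \<notin> S" for i
      using that xs(1) by (auto simp: v_def d_def intro!: sum.neutral)
    ultimately have v0: "v = 0\<^sub>v N" using inj[of v] Mc by (simp add: v_def)
    show ?thesis
    proof (rule eq_vecI)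
      fix k assume "k < dim_vec (0\<^sub>v d :: 'a vec)"
      then have k: "k < d" by simp
      have "v $ (xs ! k) = (\<Sum>l<d. if l = k then c $ l else 0)"
        using xsN k xs(2) by (auto simp: v_def d_def nth_eq_iff_index_eq intro!: sum.cong)
      then show "c $ k = 0\<^sub>v d $ k" using k v0 xsN by simp
    qed (use c in simp)
  qed
  \<comment> \<open>Linear independence is a property of the set of columns, so repeated columns
    must be excluded separately. Two equal ones would put a difference of unit vectors in the kernel
    of \<open>M\<close>.\<close>
  have dist: "distinct (cols M)"
  proof (rule ccontr)
    assume "\<not> distinct (cols M)"
    then obtain k l where kl: "k < d" "l < d" "k \<noteq> l" "col M k = col M l"
      using M by (metis carrier_matD(2) cols_length cols_nth distinct_conv_nth)
    have unit: "M *\<^sub>v unit_vec d q = col M q" if "q < d" for q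
      using M that by (intro eq_vecI) auto
    have "M *\<^sub>v (unit_vec d k - unit_vec d l) = M *\<^sub>v unit_vec d k - M *\<^sub>v unit_vec d l"
      using M by (intro mult_minus_distrib_mat_vec) auto
    also have "\<dots> = 0\<^sub>v N"
      using kl by (simp add: unit) (use M in auto)
    finally have "unit_vec d k - unit_vec d l = (0\<^sub>v d :: 'a vec)"
      by (intro ker) auto
    then have "(unit_vec d k - unit_vec d l) $ k = (0\<^sub>v d :: 'a vec) $ k" by simp
    then show False using kl by simp
  qed
  have "lin_indpt (set (cols M))"
    using lin_depE[OF M _ dist] ker by blast
  moreover have "set (cols M) \<subseteq> set (cols B)"
  proof
    fix u assume "u \<in> set (cols M)"
    then obtain k where k: "k < d" "u = col M k"
      using M by (metis carrier_matD(2) cols_length cols_nth in_set_conv_nth)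
    then have "u = col B (xs ! k)" using M B xsN by (auto simp: M_def)
    then show "u \<in> set (cols B)"
      using B xsN k by (metis carrier_matD(2) cols_length cols_nth nth_mem)
  qed
  ultimately have "card (set (cols M)) \<le> rank B"
    using rank_ge_card_indpt[OF B] by blast
  then show ?thesis
    using distinct_card[OF dist] distinct_card[OF xs(2)] xs(1) M by (simp add: d_def)
qed

section \<open>Positive semidefinite matrices\<close>

lemma psd_mat_carrier: "psd_mat N B \<Longrightarrow> B \<in> carrier_mat N N"
  and psd_mat_transpose: "psd_mat N B \<Longrightarrow> B\<^sup>T = B"
  and psd_mat_nonneg: "psd_mat N B \<Longrightarrow> x \<in> carrier_vec N \<Longrightarrow> x \<bullet> (B *\<^sub>v x) \<ge> 0"
  by (auto simp: psd_mat_def)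

lemma psd_mat_index_commute:
  assumes "psd_mat N B" "i < N" "j < N"
  shows "B $$ (i, j) = B $$ (j, i)"
  using psd_mat_transpose[OF assms(1)] psd_mat_carrier[OF assms(1)] assms(2,3)
  by (metis carrier_matD index_transpose_mat(1))

text \<open>With \<open>y = B *\<^sub>v x\<close>, the quadratic form at \<open>x + t y\<close> has
  no constant term and its linear term is twice \<open>t\<close> times the squared length of
  \<open>y\<close>. For small negative \<open>t\<close> this term dominates, so nonnegativity forces
  \<open>y\<close> to vanish.\<close>

lemma psd_mat_kernel:
  assumes psd: "psd_mat N B" and x: "x \<in> carrier_vec N" and 0: "x \<bullet> (B *\<^sub>v x) = 0"
  shows "B *\<^sub>v x = 0\<^sub>v N"
proof -
  note B = psd_mat_carrier[OF psd]
  define y where "y = B *\<^sub>v x"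
  have y: "y \<in> carrier_vec N" using mult_mat_vec_carrier[OF B x] by (simp add: y_def)
  have By: "B *\<^sub>v y \<in> carrier_vec N" by (rule mult_mat_vec_carrier[OF B y])
  define a where "a = y \<bullet> y"
  define b where "b = y \<bullet> (B *\<^sub>v y)"
  have xBy: "x \<bullet> (B *\<^sub>v y) = a"
    using transpose_vec_mult_scalar[OF B y x] psd_mat_transpose[OF psd] comm_scalar_prod[OF x By]
      comm_scalar_prod[OF y y]
    by (simp add: y_def a_def)
  have quad: "0 \<le> 2 * t * a + t\<^sup>2 * b" for t
  proof -
    have "B *\<^sub>v (x + t \<cdot>\<^sub>v y) = y + t \<cdot>\<^sub>v (B *\<^sub>v y)"
      using B x y by (simp add: mult_add_distrib_mat_vec[OF B] mult_mat_vec[OF B] y_def)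
    then have "(x + t \<cdot>\<^sub>v y) \<bullet> (B *\<^sub>v (x + t \<cdot>\<^sub>v y)) = 2 * t * a + t\<^sup>2 * b"
      using x y By xBy 0
      by (simp add: scalar_prod_add_distrib[of _ N] add_scalar_prod_distrib[of _ N]
          a_def b_def power2_eq_square flip: y_def)
    moreover have "x + t \<cdot>\<^sub>v y \<in> carrier_vec N" using x y by simp
    ultimately show ?thesis using psd_mat_nonneg[OF psd] by metis
  qed
  have a0: "a \<ge> 0" unfolding a_def scalar_prod_def by (intro sum_nonneg) simp
  have b0: "b \<ge> 0" unfolding b_def by (rule psd_mat_nonneg[OF psd y])
  have "a = 0"
  proof (rule ccontr)
    assume "a \<noteq> 0"
    then have a: "a > 0" using a0 by simp
    \<comment> \<open>The denominator \<open>b + 1\<close> is positive even if \<open>b = 0\<close>.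
      This choice turns the quadratic into \<open>t * a - t\<^sup>2\<close> with \<open>t\<close>
      negative.\<close>
    define t where "t = - a / (b + 1)"
    have tb: "t * b = - a - t" using b0 by (simp add: t_def field_simps)
    have "2 * t * a + t\<^sup>2 * b = 2 * t * a + t * (t * b)" by (simp add: power2_eq_square)
    also have "\<dots> = t * a - t\<^sup>2" by (simp add: tb power2_eq_square right_diff_distrib)
    finally have "2 * t * a + t\<^sup>2 * b = t * a - t\<^sup>2" .
    moreover have "t * a < 0" using a b0 by (simp add: t_def divide_less_0_iff mult_neg_pos)
    ultimately show False using quad[of t] zero_le_power2[of t] by linarith
  qed
  then have "\<forall>i<N. y $ i = 0"
    using y by (simp add: a_def scalar_prod_def sum_nonneg_eq_0_iff)
  then show ?thesis using y unfolding y_def[symmetric] by (intro eq_vecI) auto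
qed

text \<open>The quadratic form is a sum of squares of linear forms, one for each
  \<open>r\<close>.\<close>

lemma psd_mat_gram:
  fixes h :: "'r \<Rightarrow> nat \<Rightarrow> real"
  shows "psd_mat N (mat N N (\<lambda>(i, j). \<Sum>r\<in>R. h r i * h r j))" (is "psd_mat N ?B")
  unfolding psd_mat_def
proof (intro conjI ballI)
  show "?B\<^sup>T = ?B" by (intro eq_matI) (auto simp: mult.commute)
  fix x :: "real vec" assume x: "x \<in> carrier_vec N"
  have "x \<bullet> (?B *\<^sub>v x) = (\<Sum>i<N. x $ i * (\<Sum>j<N. (\<Sum>r\<in>R. h r i * h r j) * x $ j))"
    using x by (simp add: scalar_prod_def atLeast0LessThan)
  also have "\<dots> = (\<Sum>i<N. \<Sum>j<N. \<Sum>r\<in>R. h r i * x $ i * (h r j * x $ j))"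
    by (simp add: sum_distrib_left sum_distrib_right mult_ac)
  also have "\<dots> = (\<Sum>i<N. \<Sum>r\<in>R. \<Sum>j<N. h r i * x $ i * (h r j * x $ j))"
    by (intro sum.cong refl sum.swap)
  also have "\<dots> = (\<Sum>r\<in>R. \<Sum>i<N. \<Sum>j<N. h r i * x $ i * (h r j * x $ j))"
    by (rule sum.swap)
  also have "\<dots> = (\<Sum>r\<in>R. (\<Sum>i<N. h r i * x $ i)\<^sup>2)"
    by (simp add: power2_eq_square sum_product)
  also have "\<dots> \<ge> 0" by (intro sum_nonneg) simp
  finally show "x \<bullet> (?B *\<^sub>v x) \<ge> 0" .
qed simp

text \<open>\<open>wS\<close> and \<open>wT\<close> are the matrix form of the private neighbour
  argument: some row of \<open>B\<close>, restricted to the set, is nonzero exactly at the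
  prescribed column. Such a row isolates one coefficient of a vanishing combination of the columns
  in that set.\<close>

lemma psd_mat_card_le_rank:
  assumes psd: "psd_mat N B"
    and S: "S \<subseteq> {..<N}" and T: "T \<subseteq> {..<N}" and disj: "S \<inter> T = {}"
    and orth: "\<And>i j. i \<in> S \<Longrightarrow> j \<in> T \<Longrightarrow> B $$ (i, j) = 0"
    and wS: "\<And>i. i \<in> S \<Longrightarrow> \<exists>k<N. \<forall>j\<in>S. B $$ (k, j) = 0 \<longleftrightarrow> j \<noteq> i"
    and wT: "\<And>i. i \<in> T \<Longrightarrow> \<exists>k<N. \<forall>j\<in>T. B $$ (k, j) = 0 \<longleftrightarrow> j \<noteq> i"
  shows "card S + card T \<le> vec_space.rank N B"
proof -
  note B = psd_mat_carrier[OF psd]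
  \<comment> \<open>Stated for generic \<open>U\<close> and \<open>W\<close>, so that it applies
    once to \<open>S\<close>, \<open>T\<close> and once with the roles exchanged.\<close>
  have block: "v $ i = 0"
    if v: "v \<in> carrier_vec N" and supp: "\<And>i. i < N \<Longrightarrow> i \<notin> U \<union> W \<Longrightarrow> v $ i = 0"
      and Bv: "B *\<^sub>v v = 0\<^sub>v N" and U: "U \<subseteq> {..<N}" and UW: "U \<inter> W = {}"
      and o: "\<And>i j. i < N \<Longrightarrow> j < N \<Longrightarrow> i \<in> U \<Longrightarrow> j \<in> W \<Longrightarrow> B $$ (i, j) = 0"
      and w: "\<And>i. i \<in> U \<Longrightarrow> \<exists>k<N. \<forall>j\<in>U. B $$ (k, j) = 0 \<longleftrightarrow> j \<noteq> i"
      and i: "i \<in> U" for v U W i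
  proof -
    define x where "x = vec N (\<lambda>i. if i \<in> U then v $ i else 0)"
    define y where "y = vec N (\<lambda>i. if i \<in> W then v $ i else 0)"
    have xy: "x \<in> carrier_vec N" "y \<in> carrier_vec N" by (auto simp: x_def y_def)
    have vxy: "v = x + y"
      using v supp UW by (intro eq_vecI) (auto simp: x_def y_def)
    have "x \<bullet> (B *\<^sub>v y) = (\<Sum>i<N. \<Sum>j<N. x $ i * (B $$ (i, j) * y $ j))"
      using B by (simp add: x_def y_def scalar_prod_def atLeast0LessThan sum_distrib_left)
    also have "\<dots> = 0"
      using o by (intro sum.neutral ballI) (auto simp: x_def y_def)
    finally have xBy: "x \<bullet> (B *\<^sub>v y) = 0" .
    \<comment> \<open>The left side is zero because \<open>v\<close> lies in the kernel, and the
      cross term is zero by orthogonality; hence the form vanishes at \<open>x\<close>, and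
      \<open>x\<close> itself is in the kernel.\<close>
    have "x \<bullet> (B *\<^sub>v v) = x \<bullet> (B *\<^sub>v x) + x \<bullet> (B *\<^sub>v y)"
      using B xy by (simp add: vxy mult_add_distrib_mat_vec[OF B] scalar_prod_add_distrib[of _ N])
    then have "x \<bullet> (B *\<^sub>v x) = 0" using Bv xBy xy by simp
    then have Bx: "B *\<^sub>v x = 0\<^sub>v N" by (rule psd_mat_kernel[OF psd xy(1)])
    obtain k where k: "k < N" "\<And>j. j \<in> U \<Longrightarrow> B $$ (k, j) = 0 \<longleftrightarrow> j \<noteq> i"
      using w[OF i] by blast
    have "(B *\<^sub>v x) $ k = (\<Sum>j<N. B $$ (k, j) * x $ j)"
      using B k(1) by (simp add: x_def scalar_prod_def atLeast0LessThan)
    \<comment> \<open>On the support of \<open>x\<close>, row \<open>k\<close> is nonzero only in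
      column \<open>i\<close>.\<close>
    also have "\<dots> = (\<Sum>j<N. if j = i then B $$ (k, i) * x $ i else 0)"
      using k(2) by (intro sum.cong) (auto simp: x_def)
    also have "\<dots> = B $$ (k, i) * v $ i"
      using i U by (auto simp: x_def)
    finally show ?thesis using Bx k i by simp
  qed
  have "v = 0\<^sub>v N"
    if v: "v \<in> carrier_vec N" and supp: "\<And>i. i < N \<Longrightarrow> i \<notin> S \<union> T \<Longrightarrow> v $ i = 0"
      and Bv: "B *\<^sub>v v = 0\<^sub>v N" for v
  proof (rule eq_vecI)
    fix i assume "i < dim_vec (0\<^sub>v N :: real vec)"
    then have iN: "i < N" by simp
    have "v $ i = 0" if "i \<in> S"
      using block[OF v supp Bv S disj orth wS that] by blast
    moreover have "v $ i = 0" if "i \<in> T"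
    proof (rule block[OF v _ Bv T _ _ wT that, of S])
      show "v $ i = 0" if "i < N" "i \<notin> T \<union> S" for i using supp that by blast
      show "B $$ (i, j) = 0" if "i < N" "j < N" "i \<in> T" "j \<in> S" for i j
        using orth[of j i] psd_mat_index_commute[OF psd] that by auto
    qed (use disj in auto)
    ultimately show "v $ i = 0\<^sub>v N $ i" using supp[OF iN] iN by auto
  qed (use v in simp)
  then have "card (S \<union> T) \<le> vec_space.rank N B"
    using S T by (intro card_le_rank[OF B]) auto
  moreover have "finite S" "finite T" using S T finite_subset by blast+
  ultimately show ?thesis using card_Un_disjoint[of S T] disj by simp
qed

section \<open>The rook's graph\<close>

lemma edge_complete_graph:
  "{u, v} \<in> edges (complete_graph n) \<longleftrightarrow> u \<in> {1..n} \<and> v \<in> {1..n} \<and> u \<noteq> v"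
  by (auto simp: complete_graph_def doubleton_eq_iff)

lemma edge_cartesian_product:
  "{(i, j), (k, l)} \<in> edges (G \<box> H) \<longleftrightarrow>
    i \<in> verts G \<and> k \<in> verts G \<and> j \<in> verts H \<and> l \<in> verts H \<and>
    (i = k \<and> {j, l} \<in> edges H \<or> j = l \<and> {i, k} \<in> edges G)" (is "?L \<longleftrightarrow> ?R")
proof
  assume ?L
  then show ?R
    by (auto simp: cartesian_product_def doubleton_eq_iff insert_commute)
next
  assume ?R
  then show ?L unfolding cartesian_product_def snd_conv by blast
qed

lemma edge_rook:
  "{(i, j), (k, l)} \<in> edges (complete_graph n \<box> complete_graph m) \<longleftrightarrow>
    i \<in> {1..n} \<and> k \<in> {1..n} \<and> j \<in> {1..m} \<and> l \<in> {1..m} \<and> (i = k \<and> j \<noteq> l \<or> j = l \<and> i \<noteq> k)"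
  unfolding edge_cartesian_product edge_complete_graph by (auto simp: complete_graph_def)

lemma verts_rook: "verts (complete_graph n \<box> complete_graph m) = {1..n} \<times> {1..m}"
  by (simp add: cartesian_product_def complete_graph_def)

text \<open>An unordered pair may enter the edge set through either of two mirrored entries;
  symmetry of \<open>B\<close> makes the two conditions agree.\<close>

lemma edge_graph_of_mat:
  assumes "psd_mat N B"
  shows "{i, j} \<in> edges (graph_of_mat B) \<longleftrightarrow>
    i \<in> {1..N} \<and> j \<in> {1..N} \<and> i \<noteq> j \<and> B $$ (i - 1, j - 1) \<noteq> 0"
proof -
  have "B $$ (j - 1, i - 1) = B $$ (i - 1, j - 1)" if "i \<in> {1..N}" "j \<in> {1..N}"
    using that by (intro psd_mat_index_commute[OF assms]) auto
  moreover have "dim_row B = N" using psd_mat_carrier[OF assms] by simp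
  ultimately show ?thesis by (auto simp: graph_of_mat_def doubleton_eq_iff)
qed

lemma rook_rank_ge:
  assumes n: "n \<ge> 2" and m: "m \<ge> 2" and psd: "psd_mat N B"
    and iso: "graph_iso (graph_of_mat B) (complete_graph n \<box> complete_graph m)"
  shows "n + m - 2 \<le> vec_space.rank N B"
proof -
  let ?G = "complete_graph n \<box> complete_graph m"
  let ?V = "{1..n} \<times> {1..m}"
  have vB: "verts (graph_of_mat B) = {1..N}"
    using psd_mat_carrier[OF psd] by (simp add: graph_of_mat_def)
  obtain f where f: "bij_betw f {1..N} ?V"
    and e: "\<And>u v. u \<in> {1..N} \<Longrightarrow> v \<in> {1..N} \<Longrightarrow>
      {u, v} \<in> edges (graph_of_mat B) \<longleftrightarrow> {f u, f v} \<in> edges ?G"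
    using iso unfolding graph_iso_def vB verts_rook by blast
  define g where "g = inv_into {1..N} f"
  have g: "bij_betw g ?V {1..N}" unfolding g_def by (rule bij_betw_inv_into[OF f])
  have fg: "f (g p) = p" if "p \<in> ?V" for p
    unfolding g_def using bij_betw_inv_into_right[OF f that] .
  \<comment> \<open>The zero-based row index of the vertex \<open>(i, j)\<close>. Labels are at
    least 1, so the truncated subtraction loses nothing and \<open>h\<close> stays
    injective.\<close>
  define h where "h i j = g (i, j) - 1" for i j
  have g_in: "g p \<in> {1..N}" if "p \<in> ?V" for p using bij_betwE[OF g] that by blast
  have h_lt: "h i j < N" if "i \<in> {1..n}" "j \<in> {1..m}" for i j
    using g_in[of "(i, j)"] that unfolding h_def by auto
  have h_eq: "h i j = h k l \<longleftrightarrow> i = k \<and> j = l"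
    if "i \<in> {1..n}" "j \<in> {1..m}" "k \<in> {1..n}" "l \<in> {1..m}" for i j k l
  proof -
    have "h i j = h k l \<longleftrightarrow> g (i, j) = g (k, l)"
      using g_in[of "(i, j)"] g_in[of "(k, l)"] that unfolding h_def by auto
    then show ?thesis using that by (metis SigmaI fg prod.inject)
  qed
  have Bh: "B $$ (h i j, h k l) \<noteq> 0 \<longleftrightarrow> i = k \<or> j = l"
    if "i \<in> {1..n}" "j \<in> {1..m}" "k \<in> {1..n}" "l \<in> {1..m}" "(i, j) \<noteq> (k, l)" for i j k l
  proof -
    have "B $$ (h i j, h k l) \<noteq> 0 \<longleftrightarrow> {g (i, j), g (k, l)} \<in> edges (graph_of_mat B)"
      using that h_eq[of i j k l] g_in[of "(i, j)"] g_in[of "(k, l)"]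
      unfolding edge_graph_of_mat[OF psd] by (auto simp: h_def)
    also have "\<dots> \<longleftrightarrow> {(i, j), (k, l)} \<in> edges ?G"
      using e[of "g (i, j)" "g (k, l)"] g_in[of "(i, j)"] g_in[of "(k, l)"] fg that by auto
    finally show ?thesis using that by (auto simp: edge_rook)
  qed
  \<comment> \<open>Starting both ranges at 2 omits the corner, so a vertex of \<open>S\<close> and
    one of \<open>T\<close> differ in both coordinates and are not adjacent.\<close>
  define S where "S = h 1 ` {2..m}"
  define T where "T = (\<lambda>i. h i 1) ` {2..n}"
  have "card S = m - 1" unfolding S_def
    using n h_eq by (subst card_image) (auto simp: inj_on_def)
  moreover have "card T = n - 1" unfolding T_def
    using m h_eq by (subst card_image) (auto simp: inj_on_def)
  moreover have "card S + card T \<le> vec_space.rank N B"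
  proof (rule psd_mat_card_le_rank[OF psd])
    show "S \<subseteq> {..<N}" "T \<subseteq> {..<N}" using n m h_lt by (auto simp: S_def T_def)
    show "S \<inter> T = {}" using n m h_eq by (auto simp: S_def T_def)
    show "B $$ (i, j) = 0" if ij: "i \<in> S" "j \<in> T" for i j
    proof -
      obtain a b where "a \<in> {2..m}" "b \<in> {2..n}" "i = h 1 a" "j = h b 1"
        using ij by (auto simp: S_def T_def)
      then show ?thesis using Bh[of 1 a b 1] n m by auto
    qed
    show "\<exists>k<N. \<forall>j\<in>S. B $$ (k, j) = 0 \<longleftrightarrow> j \<noteq> i" if i: "i \<in> S" for i
    proof -
      obtain a where a: "a \<in> {2..m}" "i = h 1 a" using i by (auto simp: S_def)
      \<comment> \<open>The witness \<open>(2, a)\<close> exists since \<open>n\<close> is at least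
        2; it differs from \<open>(1, b)\<close> in the first coordinate, so adjacency forces
        \<open>b = a\<close>.\<close>
      have "B $$ (h 2 a, h 1 b) = 0 \<longleftrightarrow> h 1 b \<noteq> i" if "b \<in> {2..m}" for b
        using Bh[of 2 a 1 b] h_eq[of 1 b 1 a] a n m that by auto
      then show ?thesis using h_lt[of 2 a] a n by (auto simp: S_def)
    qed
    show "\<exists>k<N. \<forall>j\<in>T. B $$ (k, j) = 0 \<longleftrightarrow> j \<noteq> i" if i: "i \<in> T" for i
    proof -
      obtain a where a: "a \<in> {2..n}" "i = h a 1" using i by (auto simp: T_def)
      have "B $$ (h a 2, h b 1) = 0 \<longleftrightarrow> h b 1 \<noteq> i" if "b \<in> {2..n}" for b
        using Bh[of a 2 b 1] h_eq[of b 1 a 1] a n m that by auto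
      then show ?thesis using h_lt[of a 2] a m by (auto simp: T_def)
    qed
  qed
  ultimately show ?thesis using n m by simp
qed

lemma rook_rank_le:
  assumes m: "m \<ge> 1" and N: "N = n * m"
  obtains B where "psd_mat N B"
    "graph_iso (graph_of_mat B) (complete_graph n \<box> complete_graph m)"
    "vec_space.rank N B \<le> n + m - 1"
proof -
  let ?G = "complete_graph n \<box> complete_graph m"
  let ?V = "{1..n} \<times> {1..m}"
  have "card {1..N} = card ?V" by (simp add: N)
  then obtain f where f: "bij_betw f {1..N} ?V"
    using finite_same_card_bij[of "{1..N}" ?V] by auto
  have f_in: "fst (f (Suc p)) \<in> {1..n}" "snd (f (Suc p)) \<in> {1..m}" if "p < N" for p
    using bij_betwE[OF f] that by (auto simp: mem_Times_iff)
  \<comment> \<open>\<open>E k p\<close> and \<open>F l p\<close> are the coordinates, in the two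
    summands, of the vector attached to row \<open>p\<close>, whose vertex label is
    \<open>Suc p\<close>.\<close>
  define E :: "nat \<Rightarrow> nat \<Rightarrow> real" where "E k p = of_bool (fst (f (Suc p)) = k)" for k p
  define F :: "nat \<Rightarrow> nat \<Rightarrow> real" where "F l p = of_bool (snd (f (Suc p)) = l)" for l p
  define B where "B = mat N N (\<lambda>(p, q). \<Sum>r\<in>{1..n} <+> {1..m}. case_sum E F r p * case_sum E F r q)"
  have psd: "psd_mat N B" unfolding B_def by (rule psd_mat_gram)
  have entry: "B $$ (p, q) =
      of_bool (fst (f (Suc p)) = fst (f (Suc q))) + of_bool (snd (f (Suc p)) = snd (f (Suc q)))"
    if pq: "p < N" "q < N" for p q
  proof -
    have "(\<Sum>k\<in>{1..n}. E k p * E k q) =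
        (\<Sum>k\<in>{1..n}. if k = fst (f (Suc p)) then E k q else 0)"
      by (intro sum.cong) (auto simp: E_def)
    moreover have "(\<Sum>l\<in>{1..m}. F l p * F l q) =
        (\<Sum>l\<in>{1..m}. if l = snd (f (Suc p)) then F l q else 0)"
      by (intro sum.cong) (auto simp: F_def)
    ultimately show ?thesis
      using pq f_in[OF pq(1)] by (auto simp: B_def sum.Plus E_def F_def)
  qed
  have "graph_iso (graph_of_mat B) ?G"
    unfolding graph_iso_def
  proof (intro exI conjI ballI)
    have vB: "verts (graph_of_mat B) = {1..N}" by (simp add: graph_of_mat_def B_def)
    show "bij_betw f (verts (graph_of_mat B)) (verts ?G)" using f by (simp add: vB verts_rook)
    fix u v assume "u \<in> verts (graph_of_mat B)" "v \<in> verts (graph_of_mat B)"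
    then have uv: "u \<in> {1..N}" "v \<in> {1..N}" by (auto simp: vB)
    obtain i j k l where fuv: "f u = (i, j)" "f v = (k, l)" by fastforce
    have V: "(i, j) \<in> ?V" "(k, l) \<in> ?V" using bij_betwE[OF f] uv fuv by metis+
    \<comment> \<open>Diagonal entries equal 2 without being edges, so injectivity of
      \<open>f\<close> is what separates them from adjacent pairs.\<close>
    have "u = v \<longleftrightarrow> (i, j) = (k, l)"
      using bij_betw_imp_inj_on[OF f] uv fuv by (metis inj_onD)
    moreover have "B $$ (u - 1, v - 1) = of_bool (i = k) + of_bool (j = l)"
      using entry[of "u - 1" "v - 1"] uv fuv by auto
    ultimately show "{u, v} \<in> edges (graph_of_mat B) \<longleftrightarrow> {f u, f v} \<in> edges ?G"
      using uv V unfolding fuv edge_rook edge_graph_of_mat[OF psd] by auto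
  qed
  moreover have "vec_space.rank N B \<le> card ({1..n} <+> {1..m - 1})"
  proof (rule rank_sum_product_entries_le[where nc = N and f = "case_sum E F" and
        g = "case_sum (\<lambda>k q. E k q + F m q) (\<lambda>l q. F l q - F m q)"])
    \<comment> \<open>Eliminates the row vector \<open>F m\<close> through the relation \<open>\<Sum>k. E k = \<Sum>l. F l\<close>.\<close>
    show "B $$ (p, q) = (\<Sum>r\<in>{1..n} <+> {1..m - 1}. case_sum E F r p *
        case_sum (\<lambda>k q. E k q + F m q) (\<lambda>l q. F l q - F m q) r q)" if pq: "p < N" "q < N" for p q
    proof -
      have "(\<Sum>k\<in>{1..n}. E k p * (E k q + F m q)) =
          (\<Sum>k\<in>{1..n}. if k = fst (f (Suc p)) then E k q + F m q else 0)"
        by (intro sum.cong) (auto simp: E_def)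
      moreover have "(\<Sum>l\<in>{1..m - 1}. F l p * (F l q - F m q)) =
          (\<Sum>l\<in>{1..m - 1}. if l = snd (f (Suc p)) then F l q - F m q else 0)"
        by (intro sum.cong) (auto simp: F_def)
      \<comment> \<open>In the first case the two occurrences of \<open>F m q\<close> cancel. In the
        second the sum over \<open>l\<close> is empty of contributions, and the \<open>F m q\<close>
        from the sum over \<open>k\<close> is the required term.\<close>
      moreover have "snd (f (Suc p)) \<in> {1..m - 1} \<or> snd (f (Suc p)) = m"
        using f_in(2)[OF pq(1)] by auto
      ultimately show ?thesis
        using f_in[OF pq(1)] m by (auto simp: entry[OF pq] sum.Plus E_def F_def)
    qed
  qed (simp_all add: B_def)
  then have "vec_space.rank N B \<le> n + m - 1" using m by (simp add: card_Plus)
  ultimately show ?thesis using that psd by blast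
qed

theorem theorem3p10:
  fixes n m :: nat
  assumes "n \<ge> 2" and "m \<ge> 2"
  shows "mr_plus (complete_graph n \<box> complete_graph m) = n + m - 2 \<or>
         mr_plus (complete_graph n \<box> complete_graph m) = n + m - 1"
proof -
  let ?G = "complete_graph n \<box> complete_graph m"
  let ?P = "\<lambda>r. \<exists>B. psd_mat (card (verts ?G)) B \<and> graph_iso (graph_of_mat B) ?G \<and>
    r = vec_space.rank (card (verts ?G)) B"
  obtain B where B: "psd_mat (card (verts ?G)) B" "graph_iso (graph_of_mat B) ?G"
    "vec_space.rank (card (verts ?G)) B \<le> n + m - 1"
    using rook_rank_le[of m "card (verts ?G)" n] assms(2) by (auto simp: verts_rook)
  have "mr_plus ?G \<le> n + m - 1"
    unfolding mr_plus_def using B by (intro order.trans[OF Least_le[of ?P] B(3)]) blast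
  \<comment> \<open>The matrix from the upper bound shows that admissible ranks exist, so the least
    one is attained and the lower bound, valid for every admissible matrix, applies to it.\<close>
  moreover have "?P (mr_plus ?G)"
    unfolding mr_plus_def by (rule LeastI_ex) (use B in blast)
  then have "n + m - 2 \<le> mr_plus ?G"
    using rook_rank_ge[OF assms] by auto
  ultimately show ?thesis by linarith
qed

end
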